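(* Let $G$ be a finite simple undirected connected graph with vertex set $V(G)$ and edge set $E(G)$, and let $M$ be a doubly nonnegative matrix indexed by $V(G)$. Then $$4\cdot\Bigl(\sum_{uv\in E(G)}\sqrt{M_{uv}}\Bigr)^{2}\le q(G)\cdot\mathbf 1^{\top}M\mathbf 1,$$ where $q(G):=2|E(G)|-|V(G)|+1$.
   Context: All graphs are finite, simple, and undirected. A real symmetric matrix $M$ is doubly nonnegative if it is positive semidefinite and all of its entries are nonnegative. The vector $\mathbf 1$ is the all-ones vector indexed by $V(G)$, so $\mathbf 1^{\top}M\mathbf 1$ is the sum of all entries of $M$. The sum $\sum_{uv\in E(G)}$ runs over the (unordered) edges of $G$, each edge counted once. No support condition on $M$ is assumed. *)

theory Defs
  imports "HOL-Analysis.Analysis"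
begin

(* A graph is given by its edge set E; its vertex set is the whole finite type 'v. *)
definition simple_graph :: "'v::finite set set \<Rightarrow> bool" where
  "simple_graph E \<longleftrightarrow> (\<forall>e\<in>E. card e = 2)"

definition connected_graph :: "'v::finite set set \<Rightarrow> bool" where
  "connected_graph E \<longleftrightarrow> (\<forall>u v. (u, v) \<in> {(x, y). {x, y} \<in> E}\<^sup>*)"

definition graph_q :: "'v::finite set set \<Rightarrow> int" where
  "graph_q E = 2 * int (card E) - int CARD('v) + 1"

definition positive_semidefinite :: "real^'v^'v \<Rightarrow> bool" where
  "positive_semidefinite M \<longleftrightarrow> transpose M = M \<and> (\<forall>x. 0 \<le> x \<bullet> (M *v x))"

definition doubly_nonnegative :: "real^'v^'v \<Rightarrow> bool" where
  "doubly_nonnegative M \<longleftrightarrow> positive_semidefinite M \<and> (\<forall>u v. 0 \<le> M $ u $ v)"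

(* The entry at an unordered pair; unique only for symmetric M, see edge_entry_eq. *)
definition edge_entry :: "real^'v^'v \<Rightarrow> 'v set \<Rightarrow> real" where
  "edge_entry M e = (THE x. \<exists>u v. e = {u, v} \<and> x = M $ u $ v)"

lemma edge_entry_eq:
  assumes "transpose M = M"
  shows "edge_entry M {u, v} = M $ u $ v"
proof -
  have sym: "M $ a $ b = M $ b $ a" for a b
    using assms by (metis transpose_def vec_lambda_beta)
  show ?thesis
    unfolding edge_entry_def
    by (rule the_equality) (auto simp: doubleton_eq_iff sym)
qed

end

theory Submission
  imports Defs
begin

text \<open>
  The proof is by duality. An arc is an edge with an orientation, so the square root of
  the left-hand side is \<open>\<Sum> sqrt (M u v)\<close> over all arcs. Suppose that unit vectors are assigned to the
  vertices, with Gram matrix \<open>K\<close>, and that \<open>K u v \<le> 0\<close> on every arc. By the Cauchy--Schwarz inequality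
  with weights \<open>1 - K u v\<close>, the left-hand side is at most
  \<open>(\<Sum> 1 / (1 - K u v)) * (\<Sum> (1 - K u v) * M u v)\<close>, both sums over arcs. In the second factor all
  entries of \<open>1 - K\<close> and of \<open>M\<close> are nonnegative, so the sum may be extended to all pairs of vertices;
  since the pairing of two positive semidefinite matrices is nonnegative, it is then at most the sum
  of all entries of \<open>M\<close>. Since \<open>1 / (1 - x) = 1 - gain x\<close> with \<open>gain x = - x / (1 - x)\<close>, the first
  factor is at most \<open>q(G)\<close> as soon as the gains of \<open>K\<close> over all arcs add up to at least
  \<open>n - 1\<close>, where \<open>n\<close> is the number of vertices. So it suffices to find such a \<open>K\<close> for every connected
  graph (\<open>good_kernel_exists\<close>), which is done by induction on \<open>n\<close>.

  If the graph has a cut vertex \<open>c\<close>, it is the union of two smaller connected graphs that share only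
  \<open>c\<close>. Their kernels can be glued at \<open>c\<close> without changing them on either side, and both the total
  gain and \<open>n - 1\<close> are additive (\<open>good_kernel_glue\<close>).

  If \<open>n \<ge> 3\<close> and there is no cut vertex, every graph \<open>G - w\<close> has a kernel by induction.
  Extend each of these by zero at \<open>w\<close>, average over \<open>w\<close>, and renormalise the diagonal, which has become
  \<open>(n - 1) / n\<close>, to one (\<open>good_kernel_average\<close>). The gain is concave, so averaging the \<open>n - 2\<close>
  kernels which see a given arc does not lose anything; the vanishing of the other two
  kernels costs a factor \<open>(n - 2) / (n - 1)\<close> in the correlation. The new gain is a convex function
  of the old one, and its tangent at the value attained by the regular simplex, together with the bound
  \<open>n * (n - 1)\<close> for the number of arcs, gives exactly the total \<open>n - 1\<close>.
  Complete graphs with the simplex, and trees with their two-colouring, are cases of equality in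
  \<open>good_kernel_exists\<close>.
\<close>

section \<open>Positive kernels\<close>

text \<open>
  These are the Gram matrices, described as finite sums of rank-one matrices rather than by the
  sign of the quadratic form. Operations that are linear or bilinear and preserve rank one then preserve
  positivity by a plain induction, without any factorisation of a positive semidefinite matrix.
\<close>

inductive pos_kernel :: "('v \<Rightarrow> 'v \<Rightarrow> real) \<Rightarrow> bool" where
  zero: "pos_kernel (\<lambda>u v. 0)"
| rank_one: "pos_kernel (\<lambda>u v. y u * y v)"
| add: "pos_kernel K \<Longrightarrow> pos_kernel L \<Longrightarrow> pos_kernel (\<lambda>u v. K u v + L u v)"

text \<open>
  With an indicator function for \<open>a\<close> this restricts a kernel to a set of vertices and extends it by
  zero; with a constant it multiplies the kernel by a nonnegative number.
\<close>

lemma pos_kernel_rescale: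
  assumes "pos_kernel K"
  shows "pos_kernel (\<lambda>u v. a u * a v * K u v)"
  using assms
proof induction
  case zero
  show ?case by (simp add: pos_kernel.zero)
next
  case (rank_one y)
  show ?case using pos_kernel.rank_one[of "\<lambda>u. a u * y u"] by (simp add: mult_ac)
next
  case (add K L)
  then show ?case using pos_kernel.add[OF add.IH] by (simp add: distrib_left)
qed

lemma pos_kernel_scale:
  assumes "pos_kernel K" and "0 \<le> r"
  shows "pos_kernel (\<lambda>u v. r * K u v)"
  using pos_kernel_rescale[OF assms(1), of "\<lambda>_. sqrt r"] assms(2) by simp

lemma pos_kernel_sum:
  assumes "finite I" and "\<And>i. i \<in> I \<Longrightarrow> pos_kernel (K i)"
  shows "pos_kernel (\<lambda>u v. \<Sum>i\<in>I. K i u v)"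
  using assms
proof (induction I rule: finite_induct)
  case empty
  show ?case by (simp add: pos_kernel.zero)
next
  case (insert i I)
  then show ?case using pos_kernel.add[of "K i" "\<lambda>u v. \<Sum>i\<in>I. K i u v"] by simp
qed

text \<open>
  This is the expansion of \<open>(y u - y v)\<^sup>2 \<ge> 0\<close>, summed over the rank-one terms. On a kernel with unit
  diagonal it bounds all entries by one.
\<close>

lemma pos_kernel_polarisation:
  assumes "pos_kernel K"
  shows "2 * K u v \<le> K u u + K v v"
  using assms
proof induction
  case (rank_one y)
  show ?case using zero_le_power2[of "y u - y v"] by (simp add: power2_eq_square algebra_simps)
qed (simp_all)

text \<open>
  Each rank-one term of \<open>K\<close> contributes one value of the quadratic form of \<open>M\<close>.
\<close>

lemma pos_kernel_pairing_nonneg: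
  fixes M :: "real^'v^'v"
  assumes "pos_kernel K" and "positive_semidefinite M"
  shows "0 \<le> (\<Sum>u\<in>UNIV. \<Sum>v\<in>UNIV. K u v * M $ u $ v)"
  using assms(1)
proof induction
  case (rank_one y)
  have "(\<Sum>u\<in>UNIV. \<Sum>v\<in>UNIV. y u * y v * M $ u $ v) = (\<chi> u. y u) \<bullet> (M *v (\<chi> u. y u))"
    by (simp add: inner_vec_def matrix_vector_mult_def sum_distrib_left mult_ac)
  then show ?case using assms(2) by (simp add: positive_semidefinite_def)
qed (simp_all add: distrib_right sum.distrib)

text \<open>
  For kernels with \<open>K c c = L c c = 1\<close> on vertex sets that meet only in \<open>c\<close>, this agrees with \<open>K\<close> on the
  set \<open>A\<close> and with \<open>L\<close> on the other set, while a vertex of \<open>A\<close> and a vertex of the other set are made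
  conditionally independent given \<open>c\<close>. The factors \<open>L c c\<close> and \<open>K c c\<close>, equal to one in this
  case, are there to make the operation bilinear in \<open>K\<close> and \<open>L\<close>.
\<close>

definition glue :: "'v set \<Rightarrow> 'v \<Rightarrow> ('v \<Rightarrow> 'v \<Rightarrow> real) \<Rightarrow> ('v \<Rightarrow> 'v \<Rightarrow> real) \<Rightarrow> 'v \<Rightarrow> 'v \<Rightarrow> real" where
  "glue A c K L u v =
     (if u \<in> A then (if v \<in> A then K u v * L c c else K u c * L c v)
      else (if v \<in> A then K c v * L u c else K c c * L u v))"

text \<open>
  By bilinearity only rank one matters. There, gluing \<open>y\<close> and \<open>z\<close> gives the rank-one kernel of
  the function equal to \<open>y\<close> times \<open>z c\<close> on \<open>A\<close> and to \<open>y c\<close> times \<open>z\<close> elsewhere.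
\<close>

lemma pos_kernel_glue:
  assumes "pos_kernel K" and "pos_kernel L"
  shows "pos_kernel (glue A c K L)"
  using assms(1)
proof induction
  case zero
  have "glue A c (\<lambda>u v. 0) L = (\<lambda>u v. 0)" by (simp add: glue_def fun_eq_iff)
  then show ?case by (simp add: pos_kernel.zero)
next
  case (add K K')
  have "glue A c (\<lambda>u v. K u v + K' u v) L = (\<lambda>u v. glue A c K L u v + glue A c K' L u v)"
    by (simp add: glue_def fun_eq_iff distrib_right)
  with add.IH show ?case by (simp add: pos_kernel.add)
next
  case (rank_one y)
  from assms(2) show ?case
  proof induction
    case zero
    have "glue A c (\<lambda>u v. y u * y v) (\<lambda>u v. 0) = (\<lambda>u v. 0)" by (simp add: glue_def fun_eq_iff)
    then show ?case by (simp add: pos_kernel.zero)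
  next
    case (add L L')
    have "glue A c (\<lambda>u v. y u * y v) (\<lambda>u v. L u v + L' u v) =
        (\<lambda>u v. glue A c (\<lambda>u v. y u * y v) L u v + glue A c (\<lambda>u v. y u * y v) L' u v)"
      by (simp add: glue_def fun_eq_iff distrib_left)
    with add.IH show ?case by (simp add: pos_kernel.add)
  next
    case (rank_one z)
    have "glue A c (\<lambda>u v. y u * y v) (\<lambda>u v. z u * z v) =
        (\<lambda>u v. (if u \<in> A then y u * z c else y c * z u) * (if v \<in> A then y v * z c else y c * z v))"
      by (simp add: glue_def fun_eq_iff mult_ac)
    then show ?case by (simp add: pos_kernel.rank_one)
  qed
qed

section \<open>The gain of a correlation\<close>

text \<open>
  The amount by which the weight \<open>1 / (1 - x)\<close> of an arc in the Cauchy--Schwarz bound falls below one,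
  the weight of an arc whose ends are orthogonal.
\<close>

definition gain :: "real \<Rightarrow> real" where
  "gain x = - x / (1 - x)"

text \<open>
  Jensen's inequality: since \<open>gain x = 1 - 1 / (1 - x)\<close>, the gain is concave for \<open>x < 1\<close>.
\<close>

lemma gain_jensen:
  assumes "finite I" and "I \<noteq> {}" and "\<And>i. i \<in> I \<Longrightarrow> x i \<le> 0"
  shows "(\<Sum>i\<in>I. gain (x i)) \<le> card I * gain ((\<Sum>i\<in>I. x i) / card I)"
proof -
  define a where "a = (\<Sum>i\<in>I. x i) / card I"
  have k: "real (card I) > 0" using assms by (simp add: card_gt_0_iff)
  have a: "a \<le> 0" unfolding a_def using assms(3) by (intro divide_nonpos_nonneg sum_nonpos) auto
  have tangent: "gain (x i) \<le> gain a - (x i - a) / (1 - a)\<^sup>2" if "i \<in> I" for i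
  proof -
    have xi: "1 - x i > 0" and a1: "1 - a > 0" using assms(3)[OF that] a by auto
    have "gain a - (x i - a) / (1 - a)\<^sup>2 - gain (x i) = (x i - a)\<^sup>2 / ((1 - a)\<^sup>2 * (1 - x i))"
      using xi a1 by (simp add: gain_def divide_simps) (simp add: power2_eq_square algebra_simps)
    also have "\<dots> \<ge> 0" using xi a1 by simp
    finally show ?thesis by simp
  qed
  have "(\<Sum>i\<in>I. gain (x i)) \<le> (\<Sum>i\<in>I. gain a - (x i - a) / (1 - a)\<^sup>2)"
    by (intro sum_mono tangent)
  also have "\<dots> = card I * gain a - ((\<Sum>i\<in>I. x i) - card I * a) / (1 - a)\<^sup>2"
    by (simp add: sum_subtractf flip: sum_divide_distrib)
  also have "(\<Sum>i\<in>I. x i) - card I * a = 0" using k by (simp add: a_def)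
  finally show ?thesis by (simp add: a_def)
qed

text \<open>
  In terms of \<open>G = gain x\<close> the right-hand side is \<open>k * G / (k + 1 - G)\<close>, a convex function of \<open>G\<close>, and
  the left-hand side is its tangent at \<open>G = 1 / (k + 1)\<close>. With \<open>n = k + 2\<close> this is the gain at
  the correlation \<open>- 1 / k\<close> of a regular simplex with \<open>n - 1\<close> vertices, which shrinking turns into
  \<open>- 1 / (k + 1)\<close>, the correlation for \<open>n\<close> vertices. The inequality is an equality there, which explains the
  square \<open>(k * a - 1)\<^sup>2\<close> in the difference of the two sides.
\<close>

lemma gain_shrink:
  fixes k x :: real
  assumes "k > 0" and "x \<le> 0"
  shows "((k + 1) ^ 3 * gain x - 1) / ((k + 2)\<^sup>2 * k) \<le> gain (k * x / (k + 1))"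
proof -
  define a where "a = - x"
  have a: "a \<ge> 0" using assms by (simp add: a_def)
  have d: "k + 1 + k * a > 0" using assms a by (simp add: add_pos_nonneg)
  have g: "gain x = a / (1 + a)" by (simp add: gain_def a_def)
  have "1 + k * a / (k + 1) = (k + 1 + k * a) / (k + 1)"
    using assms by (simp add: field_simps)
  then have g': "gain (k * x / (k + 1)) = k * a / (k + 1 + k * a)"
    using assms by (simp add: gain_def a_def)
  have "k * a / (k + 1 + k * a) - ((k + 1) ^ 3 * (a / (1 + a)) - 1) / ((k + 2)\<^sup>2 * k)
      = (k + 1) * (k * a - 1)\<^sup>2 / ((k + 1 + k * a) * (1 + a) * ((k + 2)\<^sup>2 * k))"
  proof -
    have nz: "k + 1 + k * a \<noteq> 0" "1 + a \<noteq> 0" "(k + 2)\<^sup>2 * k \<noteq> 0" using d a assms by auto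
    have poly: "k * a * ((1 + a) * ((k + 2)\<^sup>2 * k)) - ((k + 1) ^ 3 * a - (1 + a)) * (k + 1 + k * a)
        = (k + 1) * (k * a - 1)\<^sup>2"
      by (simp add: power2_eq_square power3_eq_cube algebra_simps)
    have "((k + 1) ^ 3 * (a / (1 + a)) - 1) = ((k + 1) ^ 3 * a - (1 + a)) / (1 + a)"
      using nz by (simp add: diff_divide_distrib)
    then have "k * a / (k + 1 + k * a) - ((k + 1) ^ 3 * (a / (1 + a)) - 1) / ((k + 2)\<^sup>2 * k)
      = k * a / (k + 1 + k * a) - ((k + 1) ^ 3 * a - (1 + a)) / ((1 + a) * ((k + 2)\<^sup>2 * k))"
      by simp
    also have "\<dots> = (k * a * ((1 + a) * ((k + 2)\<^sup>2 * k)) - ((k + 1) ^ 3 * a - (1 + a)) * (k + 1 + k * a))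
        / ((k + 1 + k * a) * ((1 + a) * ((k + 2)\<^sup>2 * k)))"
      using nz by (subst diff_frac_eq) auto
    finally show ?thesis unfolding poly by (simp add: mult.assoc)
  qed
  also have "\<dots> \<ge> 0" using d a assms by simp
  finally show ?thesis unfolding g g' by simp
qed

section \<open>Connected vertex sets\<close>

definition arcs :: "('v \<Rightarrow> 'v \<Rightarrow> bool) \<Rightarrow> 'v set \<Rightarrow> ('v \<times> 'v) set" where
  "arcs adj S = {(u, v). u \<in> S \<and> v \<in> S \<and> adj u v}"

text \<open>
  Connectivity is expressed by cuts rather than by paths: a violation for \<open>S - {c}\<close> directly provides the
  two sides into which a cut vertex \<open>c\<close> splits \<open>S\<close>.
\<close>

definition connected_set :: "('v \<Rightarrow> 'v \<Rightarrow> bool) \<Rightarrow> 'v set \<Rightarrow> bool" where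
  "connected_set adj S \<longleftrightarrow>
     (\<forall>X. X \<noteq> {} \<longrightarrow> X \<subset> S \<longrightarrow> (\<exists>x\<in>X. \<exists>y\<in>S - X. adj x y))"

lemma connected_setD:
  assumes "connected_set adj S" and "X \<noteq> {}" and "X \<subset> S"
  obtains x y where "x \<in> X" and "y \<in> S" and "y \<notin> X" and "adj x y"
proof -
  have "\<exists>x\<in>X. \<exists>y\<in>S - X. adj x y"
    using assms(1)[unfolded connected_set_def, rule_format, OF assms(2,3)] .
  then show thesis using that by auto
qed

lemma finite_arcs: "finite S \<Longrightarrow> finite (arcs adj S)"
  by (rule finite_subset[of _ "S \<times> S"]) (auto simp: arcs_def)

lemma card_arcs_le:
  assumes "finite S" and "irreflp adj"
  shows "card (arcs adj S) \<le> card S * (card S - 1)"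
proof -
  have "arcs adj S \<subseteq> (SIGMA u:S. S - {u})"
    using assms(2) by (auto simp: arcs_def irreflp_def)
  then have "card (arcs adj S) \<le> card (SIGMA u:S. S - {u})"
    using assms(1) by (intro card_mono) auto
  also have "\<dots> = card S * (card S - 1)" using assms(1) by (simp add: card_SigmaI)
  finally show ?thesis .
qed

text \<open>
  Either \<open>Z\<close> or its complement in \<open>insert c X\<close> avoids \<open>c\<close>. That part lies inside \<open>X\<close>, so an
  arc by which it leaves itself within \<open>S\<close> cannot end on the other side of the cut.
\<close>

lemma connected_set_side:
  assumes "connected_set adj S" and "symp adj" and "c \<in> S" and "X \<subseteq> S - {c}"
    and no_arc: "\<And>x y. x \<in> X \<Longrightarrow> y \<in> S - {c} - X \<Longrightarrow> \<not> adj x y"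
  shows "connected_set adj (insert c X)"
  unfolding connected_set_def
proof (intro allI impI)
  fix Z assume Z: "Z \<noteq> {}" "Z \<subset> insert c X"
  show "\<exists>x\<in>Z. \<exists>y\<in>insert c X - Z. adj x y"
  proof (cases "c \<in> Z")
    case False
    then have "Z \<subseteq> X" "Z \<subset> S" using Z assms(3,4) by auto
    obtain x y where "x \<in> Z" "y \<in> S" "y \<notin> Z" "adj x y"
      using connected_setD[OF assms(1) Z(1) \<open>Z \<subset> S\<close>] .
    then show ?thesis using no_arc \<open>Z \<subseteq> X\<close> by blast
  next
    case True
    define W where "W = insert c X - Z"
    have W: "W \<noteq> {}" "W \<subseteq> X" "W \<subset> S" using Z True assms(3,4) by (auto simp: W_def)
    obtain x y where xy: "x \<in> W" "y \<in> S" "y \<notin> W" "adj x y"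
      using connected_setD[OF assms(1) W(1,3)] .
    then have "y \<in> Z" using no_arc W(2) True by (auto simp: W_def)
    moreover have "adj y x" using xy(4) assms(2) by (simp add: sympD)
    ultimately show ?thesis using xy(1) by (auto simp: W_def)
  qed
qed

section \<open>Kernels with large total gain\<close>

text \<open>
  The total gain ranges over arcs, so every edge counts twice and the target is \<open>card S - 1\<close> instead
  of half of it. The sign condition keeps all correlations on arcs in the range where the gain is concave,
  and it survives both gluing and averaging.
\<close>

definition good_kernel :: "('v \<Rightarrow> 'v \<Rightarrow> bool) \<Rightarrow> 'v set \<Rightarrow> ('v \<Rightarrow> 'v \<Rightarrow> real) \<Rightarrow> bool" where
  "good_kernel adj S K \<longleftrightarrow> pos_kernel K \<and> (\<forall>u\<in>S. K u u = 1) \<and>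
     (\<forall>(u, v)\<in>arcs adj S. K u v \<le> 0) \<and>
     real (card S) - 1 \<le> (\<Sum>(u, v)\<in>arcs adj S. gain (K u v))"

lemma good_kernel_glue:
  assumes "finite A" and "finite B" and "irreflp adj" and AB: "A \<inter> B = {c}"
    and no_arc: "arcs adj (A \<union> B) \<subseteq> arcs adj A \<union> arcs adj B"
    and K: "good_kernel adj A K" and L: "good_kernel adj B L"
  shows "good_kernel adj (A \<union> B) (glue A c K L)"
proof -
  have one: "K c c = 1" "L c c = 1" using K L AB by (auto simp: good_kernel_def)
  have onA: "glue A c K L u v = K u v" if "u \<in> A" "v \<in> A" for u v
    using that one by (simp add: glue_def)
  have onB: "glue A c K L u v = L u v" if "u \<in> B" "v \<in> B" for u v
  proof -
    have "u \<in> A \<Longrightarrow> u = c" "v \<in> A \<Longrightarrow> v = c" using that AB by auto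
    then show ?thesis using one by (auto simp: glue_def)
  qed
  have arcs: "arcs adj (A \<union> B) = arcs adj A \<union> arcs adj B"
    using no_arc by (auto simp: arcs_def)
  have disj: "arcs adj A \<inter> arcs adj B = {}"
  proof -
    have "u = c \<and> v = c" if "(u, v) \<in> arcs adj A \<inter> arcs adj B" for u v
      using that AB by (auto simp: arcs_def)
    then show ?thesis using assms(3) by (fastforce simp: arcs_def irreflp_def)
  qed
  have "card (A \<union> B) + 1 = card A + card B"
    using card_Un_Int[OF assms(1,2)] AB by simp
  then have card: "real (card (A \<union> B)) - 1 = (real (card A) - 1) + (real (card B) - 1)"
    by linarith
  have "(\<Sum>(u, v)\<in>arcs adj (A \<union> B). gain (glue A c K L u v))
      = (\<Sum>(u, v)\<in>arcs adj A. gain (glue A c K L u v)) + (\<Sum>(u, v)\<in>arcs adj B. gain (glue A c K L u v))"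
    unfolding arcs using disj assms(1,2) by (simp add: sum.union_disjoint finite_arcs)
  also have "\<dots> = (\<Sum>(u, v)\<in>arcs adj A. gain (K u v)) + (\<Sum>(u, v)\<in>arcs adj B. gain (L u v))"
    by (intro arg_cong2[of _ _ _ _ "(+)"] sum.cong) (auto simp: arcs_def onA onB)
  finally have "real (card (A \<union> B)) - 1 \<le> (\<Sum>(u, v)\<in>arcs adj (A \<union> B). gain (glue A c K L u v))"
    using K L unfolding card good_kernel_def by linarith
  moreover have "\<forall>(u, v)\<in>arcs adj (A \<union> B). glue A c K L u v \<le> 0"
    using K L unfolding arcs good_kernel_def by (auto simp: arcs_def onA onB)
  moreover have "\<forall>u\<in>A \<union> B. glue A c K L u u = 1"
    using K L unfolding good_kernel_def by (auto simp: onA onB)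
  ultimately show ?thesis
    using K L by (simp add: good_kernel_def pos_kernel_glue)
qed

text \<open>
  Double counting of pairs of a deleted vertex \<open>w\<close> and an arc avoiding \<open>w\<close> shows that the gains of all the
  given kernels add up to at least \<open>n * (n - 2)\<close>. For each arc, concavity and \<open>gain_shrink\<close> bound
  the gain of the averaged kernel below by an affine function of the sum of the given gains on that arc.
  The constant term of this function is negative, and it is summed over at most \<open>n * (n - 1)\<close> arcs;
  the resulting lower bound for the total is exactly \<open>n - 1\<close>.
\<close>

lemma good_kernel_average:
  assumes "finite S" and "3 \<le> card S" and "irreflp adj"
    and K: "\<And>w. w \<in> S \<Longrightarrow> good_kernel adj (S - {w}) (K w)"
  shows "\<exists>L. good_kernel adj S L"
proof -
  define k where "k = real (card S) - 2"
  have k: "k > 0" and n: "real (card S) = k + 2" using assms(2) by (auto simp: k_def)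
  \<comment> \<open>Exactly \<open>n - 1 = k + 1\<close> of the kernels have a one at a given diagonal place, so division by
    \<open>k + 1\<close> averages and renormalises at once.\<close>
  define L where "L = (\<lambda>u v. 1 / (k + 1) * (\<Sum>w\<in>S. of_bool (u \<noteq> w) * of_bool (v \<noteq> w) * K w u v))"
  have L_eq: "L u v = (\<Sum>w\<in>S - {u, v}. K w u v) / (k + 1)" for u v
  proof -
    have "(\<Sum>w\<in>S. of_bool (u \<noteq> w) * of_bool (v \<noteq> w) * K w u v) = (\<Sum>w\<in>S - {u, v}. K w u v)"
      using assms(1) by (intro sum.mono_neutral_cong_right) auto
    then show ?thesis by (simp add: L_def)
  qed
  have pos: "pos_kernel L"
    unfolding L_def using assms(1) k K
    by (intro pos_kernel_scale pos_kernel_sum pos_kernel_rescale) (auto simp: good_kernel_def)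
  have diag: "L u u = 1" if "u \<in> S" for u
  proof -
    have "(\<Sum>w\<in>S - {u}. K w u u) = (\<Sum>w\<in>S - {u}. 1)"
      using K that by (intro sum.cong) (auto simp: good_kernel_def)
    also have "\<dots> = k + 1" using that assms(1,2) n by (simp add: of_nat_diff)
    finally show ?thesis using k by (simp add: L_eq)
  qed
  have nonpos: "K w u v \<le> 0" if "(u, v) \<in> arcs adj S" "w \<in> S - {u, v}" for u v w
    using K[of w] that by (auto simp: good_kernel_def arcs_def)
  have L_nonpos: "L u v \<le> 0" if "(u, v) \<in> arcs adj S" for u v
    unfolding L_eq using nonpos[OF that] k by (intro divide_nonpos_pos sum_nonpos) auto
  have arc_gain: "((k + 1) ^ 3 * ((\<Sum>w\<in>S - {u, v}. gain (K w u v)) / k) - 1) / ((k + 2)\<^sup>2 * k)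
      \<le> gain (L u v)" if uv: "(u, v) \<in> arcs adj S" for u v
  proof -
    \<comment> \<open>The average over the \<open>k\<close> kernels that do not vanish on this arc by construction.\<close>
    define x where "x = (\<Sum>w\<in>S - {u, v}. K w u v) / k"
    have "u \<noteq> v" "u \<in> S" "v \<in> S" using uv assms(3) by (auto simp: arcs_def irreflp_def)
    then have "card (S - {u, v}) = card S - 2" using assms(1) by (simp add: card_Diff_subset)
    then have c: "real (card (S - {u, v})) = k" using assms(2) by (simp add: k_def of_nat_diff)
    then have ne: "S - {u, v} \<noteq> {}" using k by force
    have x: "x \<le> 0" unfolding x_def using nonpos[OF uv] k
      by (intro divide_nonpos_pos sum_nonpos) auto
    have "(\<Sum>w\<in>S - {u, v}. gain (K w u v)) \<le> k * gain x"
      using gain_jensen[of "S - {u, v}" "\<lambda>w. K w u v"] ne nonpos[OF uv] assms(1)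
      unfolding c x_def by auto
    then have "(\<Sum>w\<in>S - {u, v}. gain (K w u v)) / k \<le> gain x"
      using k by (simp add: field_simps)
    then have "((k + 1) ^ 3 * ((\<Sum>w\<in>S - {u, v}. gain (K w u v)) / k) - 1) / ((k + 2)\<^sup>2 * k)
        \<le> ((k + 1) ^ 3 * gain x - 1) / ((k + 2)\<^sup>2 * k)"
      using k by (intro divide_right_mono diff_right_mono mult_left_mono) auto
    also have "\<dots> \<le> gain (k * x / (k + 1))" by (rule gain_shrink[OF k x])
    also have "k * x / (k + 1) = L u v" using k by (simp add: x_def L_eq)
    finally show ?thesis .
  qed
  have total: "(k + 2) * k \<le> (\<Sum>(u, v)\<in>arcs adj S. \<Sum>w\<in>S - {u, v}. gain (K w u v))"
  proof -
    have "(k + 2) * k = (\<Sum>w\<in>S. k)" using n by simp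
    also have "\<dots> \<le> (\<Sum>w\<in>S. \<Sum>(u, v)\<in>arcs adj (S - {w}). gain (K w u v))"
    proof (intro sum_mono)
      fix w assume w: "w \<in> S"
      then have "real (card (S - {w})) - 1 = k" using assms(1,2) by (simp add: k_def of_nat_diff)
      then show "k \<le> (\<Sum>(u, v)\<in>arcs adj (S - {w}). gain (K w u v))"
        using K[OF w] by (simp add: good_kernel_def)
    qed
    also have "\<dots> = (\<Sum>w\<in>S. \<Sum>p | p \<in> arcs adj S \<and> fst p \<noteq> w \<and> snd p \<noteq> w. gain (K w (fst p) (snd p)))"
      by (intro sum.cong) (auto simp: arcs_def case_prod_unfold)
    also have "\<dots> = (\<Sum>p\<in>arcs adj S. \<Sum>w | w \<in> S \<and> fst p \<noteq> w \<and> snd p \<noteq> w. gain (K w (fst p) (snd p)))"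
      using assms(1) by (intro sum.swap_restrict finite_arcs)
    also have "\<dots> = (\<Sum>(u, v)\<in>arcs adj S. \<Sum>w\<in>S - {u, v}. gain (K w u v))"
      by (intro sum.cong) (auto intro!: sum.cong)
    finally show ?thesis .
  qed
  have card: "real (card (arcs adj S)) \<le> (k + 2) * (k + 1)"
  proof -
    have "real (card (arcs adj S)) \<le> real (card S * (card S - 1))"
      using card_arcs_le[OF assms(1,3)] of_nat_le_iff by blast
    then show ?thesis using assms(2) by (simp add: k_def of_nat_diff)
  qed
  have "real (card S) - 1 = ((k + 1) ^ 3 * ((k + 2) * k / k) - (k + 2) * (k + 1)) / ((k + 2)\<^sup>2 * k)"
  proof -
    have "(k + 1) ^ 3 * (k + 2) - (k + 2) * (k + 1) = (k + 1) * ((k + 2)\<^sup>2 * k)"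
      by (simp add: power2_eq_square power3_eq_cube algebra_simps)
    then show ?thesis using k n by simp
  qed
  also have "\<dots> \<le> ((k + 1) ^ 3 * ((\<Sum>(u, v)\<in>arcs adj S. \<Sum>w\<in>S - {u, v}. gain (K w u v)) / k)
      - card (arcs adj S)) / ((k + 2)\<^sup>2 * k)"
    using total card k by (intro divide_right_mono diff_mono mult_left_mono) auto
  also have "\<dots> = (\<Sum>(u, v)\<in>arcs adj S.
      ((k + 1) ^ 3 * ((\<Sum>w\<in>S - {u, v}. gain (K w u v)) / k) - 1) / ((k + 2)\<^sup>2 * k))"
    by (simp add: case_prod_unfold sum_subtractf sum_distrib_left flip: sum_divide_distrib)
  also have "\<dots> \<le> (\<Sum>(u, v)\<in>arcs adj S. gain (L u v))"
    using arc_gain by (intro sum_mono) auto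
  finally show ?thesis
    using pos diag L_nonpos unfolding good_kernel_def by blast
qed

text \<open>
  A single edge needs a separate treatment: it has no cut vertex, but deleting either end
  leaves no arc whose correlation could be averaged, so the ends get opposite vectors.
\<close>

lemma good_kernel_exists:
  assumes "finite S" and "S \<noteq> {}" and "symp adj" and "irreflp adj" and "connected_set adj S"
  shows "\<exists>K. good_kernel adj S K"
  using assms(1,2,5)
proof (induction "card S" arbitrary: S rule: less_induct)
  case less
  consider "card S = 1" | "card S = 2" | "3 \<le> card S"
  proof -
    have "card S > 0" using less.prems(1,2) by (simp add: card_gt_0_iff)
    then show thesis using that by linarith
  qed
  then show ?case
  proof cases
    case 1
    then obtain a where "S = {a}" by (auto simp: card_1_singleton_iff)
    moreover then have "arcs adj S = {}" using assms(4) by (auto simp: arcs_def irreflp_def)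
    ultimately have "good_kernel adj S (\<lambda>u v. 1)"
      using pos_kernel.rank_one[of "\<lambda>_. 1"] by (simp add: good_kernel_def)
    then show ?thesis by blast
  next
    case 2
    then obtain a b where S: "S = {a, b}" "a \<noteq> b" by (auto simp: card_2_iff)
    then have "{a} \<subset> S" by auto
    then obtain x y where "x \<in> {a}" "y \<in> S" "y \<notin> {a}" "adj x y"
      using connected_setD[OF less.prems(3), of "{a}"] by auto
    then have ab: "adj a b" "adj b a" using S assms(3) by (auto dest: sympD)
    have arcs: "arcs adj S = {(a, b), (b, a)}"
      using S ab assms(4) by (auto simp: arcs_def irreflp_def)
    define y :: "_ \<Rightarrow> real" where "y = (\<lambda>u. if u = a then 1 else -1)"
    have "good_kernel adj S (\<lambda>u v. y u * y v)"
      using S pos_kernel.rank_one[of y] unfolding good_kernel_def arcs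
      by (auto simp: y_def gain_def)
    then show ?thesis by blast
  next
    case 3
    show ?thesis
    proof (cases "\<forall>w\<in>S. connected_set adj (S - {w})")
      case True
      have "\<exists>K. good_kernel adj (S - {w}) K" if "w \<in> S" for w
      proof (rule less.hyps)
        show "card (S - {w}) < card S" using that less.prems(1) by (intro card_Diff1_less)
        show "S - {w} \<noteq> {}" using 3 that by (auto simp: subset_singleton_iff)
      qed (use that True less.prems in auto)
      then obtain K where "\<And>w. w \<in> S \<Longrightarrow> good_kernel adj (S - {w}) (K w)" by metis
      then show ?thesis using good_kernel_average[OF less.prems(1) 3 assms(4)] by blast
    next
      case False
      then obtain c where c: "c \<in> S" and "\<not> connected_set adj (S - {c})" by blast
      then obtain X where X: "X \<noteq> {}" "X \<subset> S - {c}"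
        and "\<not> (\<exists>x\<in>X. \<exists>y\<in>S - {c} - X. adj x y)"
        unfolding connected_set_def by metis
      then have no_arc: "\<not> adj x y" if "x \<in> X" "y \<in> S - {c} - X" for x y
        using that by metis
      define Y where "Y = S - {c} - X"
      have no_arc': "\<not> adj y x" if "y \<in> Y" "x \<in> S - {c} - Y" for x y
        using no_arc[of x y] that assms(3) by (auto simp: Y_def dest: sympD)
      have "X \<subseteq> S - {c}" "Y \<subseteq> S - {c}" using X by (auto simp: Y_def)
      then have conn: "connected_set adj (insert c X)" "connected_set adj (insert c Y)"
        using connected_set_side[OF less.prems(3) assms(3) c _ no_arc]
          connected_set_side[OF less.prems(3) assms(3) c _ no_arc'] by simp_all
      have un: "insert c X \<union> insert c Y = S" and int: "insert c X \<inter> insert c Y = {c}"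
        using c X by (auto simp: Y_def)
      have sub: "insert c X \<subset> S" "insert c Y \<subset> S" using c X by (auto simp: Y_def)
      have fin: "finite (insert c X)" "finite (insert c Y)"
        using sub less.prems(1) by (auto dest: finite_subset)
      obtain K L where "good_kernel adj (insert c X) K" "good_kernel adj (insert c Y) L"
        using less.hyps[OF psubset_card_mono[OF less.prems(1) sub(1)] fin(1) _ conn(1)]
          less.hyps[OF psubset_card_mono[OF less.prems(1) sub(2)] fin(2) _ conn(2)] by blast
      moreover have "arcs adj (insert c X \<union> insert c Y)
          \<subseteq> arcs adj (insert c X) \<union> arcs adj (insert c Y)"
      proof -
        have "\<not> adj u v" "\<not> adj v u" if "u \<in> X" "v \<in> Y" for u v
          using no_arc[of u v] no_arc'[of v u] that X by (auto simp: Y_def)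
        then show ?thesis by (auto simp: arcs_def)
      qed
      ultimately have "good_kernel adj S (glue (insert c X) c K L)"
        using good_kernel_glue[OF fin assms(4) int] unfolding un by blast
      then show ?thesis by blast
    qed
  qed
qed

section \<open>The inequality\<close>

lemma sum_arcs_eq_twice_sum_edges:
  fixes E :: "'v::finite set set" and h :: "'v set \<Rightarrow> real"
  assumes "simple_graph E"
  shows "(\<Sum>(u, v)\<in>arcs (\<lambda>u v. {u, v} \<in> E) UNIV. h {u, v}) = 2 * (\<Sum>e\<in>E. h e)"
proof -
  define R where "R = arcs (\<lambda>u v. {u, v} \<in> E) UNIV"
  define ends where "ends = (\<lambda>p :: 'v \<times> 'v. {fst p, snd p})"
  have "ends ` R \<subseteq> E" by (auto simp: R_def ends_def arcs_def)
  then have "(\<Sum>p\<in>R. h (ends p)) = (\<Sum>e\<in>E. \<Sum>p | p \<in> R \<and> ends p = e. h (ends p))"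
    using sum.group[of R E ends "\<lambda>p. h (ends p)"] by simp
  also have "\<dots> = (\<Sum>e\<in>E. 2 * h e)"
  proof (rule sum.cong[OF refl])
    fix e assume e: "e \<in> E"
    then obtain a b where ab: "e = {a, b}" "a \<noteq> b"
      using assms by (auto simp: simple_graph_def card_2_iff)
    have "{p \<in> R. ends p = e} = {(a, b), (b, a)}"
      using e unfolding ab R_def ends_def by (auto simp: arcs_def doubleton_eq_iff insert_commute[of b a])
    moreover have "ends (a, b) = e" "ends (b, a) = e" using ab by (auto simp: ends_def)
    ultimately show "(\<Sum>p | p \<in> R \<and> ends p = e. h (ends p)) = 2 * h e"
      using ab(2) by simp
  qed
  finally show ?thesis by (simp add: R_def ends_def case_prod_unfold sum_distrib_left)
qed

lemma connected_graph_imp_connected_set: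
  assumes "connected_graph E"
  shows "connected_set (\<lambda>u v. {u, v} \<in> E) UNIV"
  unfolding connected_set_def
proof (intro allI impI, rule ccontr)
  fix X :: "'a set"
  assume X: "X \<noteq> {}" "X \<subset> UNIV" and "\<not> (\<exists>x\<in>X. \<exists>y\<in>UNIV - X. {x, y} \<in> E)"
  then have closed: "y \<in> X" if "x \<in> X" "{x, y} \<in> E" for x y using that by blast
  obtain a b where ab: "a \<in> X" "b \<notin> X" using X by blast
  have "(a, b) \<in> {(x, y). {x, y} \<in> E}\<^sup>*" using assms by (simp add: connected_graph_def)
  then have "b \<in> X" using ab(1) by induction (auto intro: closed)
  with ab show False by simp
qed

theorem theorem2p1:
  fixes E :: "'v::finite set set" and M :: "real^'v^'v"
  assumes "simple_graph E" and "connected_graph E" and "doubly_nonnegative M"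
  shows "4 * (\<Sum>e\<in>E. sqrt (edge_entry M e))\<^sup>2 \<le> real_of_int (graph_q E) * (1 \<bullet> (M *v 1))"
proof -
  define adj where "adj = (\<lambda>u v. {u, v} \<in> E)"
  define R where "R = arcs adj UNIV"
  have psd: "positive_semidefinite M" and sym: "transpose M = M" and nonneg: "\<And>u v. 0 \<le> M $ u $ v"
    using assms(3) by (auto simp: doubly_nonnegative_def positive_semidefinite_def)
  have "symp adj" by (simp add: adj_def symp_def insert_commute)
  moreover have "irreflp adj" using assms(1) by (force simp: adj_def irreflp_def simple_graph_def)
  ultimately obtain K where "good_kernel adj UNIV K"
    using good_kernel_exists[of UNIV adj] connected_graph_imp_connected_set[OF assms(2)]
    by (auto simp: adj_def)
  then have pos: "pos_kernel K" and diag: "\<And>u. K u u = 1"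
    and K_nonpos: "\<And>u v. (u, v) \<in> R \<Longrightarrow> K u v \<le> 0"
    and K_gain: "real CARD('v) - 1 \<le> (\<Sum>(u, v)\<in>R. gain (K u v))"
    by (auto simp: good_kernel_def R_def)
  have le1: "K u v \<le> 1" for u v
    using pos_kernel_polarisation[OF pos, of u v] by (simp add: diag)
  have lhs: "(\<Sum>(u, v)\<in>R. sqrt (M $ u $ v)) = 2 * (\<Sum>e\<in>E. sqrt (edge_entry M e))"
    using sum_arcs_eq_twice_sum_edges[OF assms(1), of "\<lambda>e. sqrt (edge_entry M e)"]
    by (simp add: R_def adj_def edge_entry_eq[OF sym])
  have card: "real (card R) = 2 * real (card E)"
    using sum_arcs_eq_twice_sum_edges[OF assms(1), of "\<lambda>e. 1"]
    by (simp add: R_def adj_def case_prod_unfold)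
  have q: "(\<Sum>(u, v)\<in>R. 1 / (1 - K u v)) \<le> graph_q E"
  proof -
    have "(\<Sum>(u, v)\<in>R. 1 / (1 - K u v)) = (\<Sum>(u, v)\<in>R. 1 - gain (K u v))"
    proof (intro sum.cong refl, clarify)
      fix u v assume "(u, v) \<in> R"
      then have "1 - K u v > 0" using K_nonpos by force
      then show "1 / (1 - K u v) = 1 - gain (K u v)" by (simp add: gain_def field_simps)
    qed
    also have "\<dots> = card R - (\<Sum>(u, v)\<in>R. gain (K u v))"
      by (simp add: case_prod_unfold sum_subtractf)
    also have "\<dots> \<le> graph_q E" using K_gain card by (simp add: graph_q_def)
    finally show ?thesis .
  qed
  have T: "(\<Sum>(u, v)\<in>R. (1 - K u v) * M $ u $ v) \<le> 1 \<bullet> (M *v 1)"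
  proof -
    have "(\<Sum>(u, v)\<in>R. (1 - K u v) * M $ u $ v) \<le> (\<Sum>(u, v)\<in>UNIV \<times> UNIV. (1 - K u v) * M $ u $ v)"
      using le1 nonneg by (intro sum_mono2) auto
    also have "\<dots> = (\<Sum>u\<in>UNIV. \<Sum>v\<in>UNIV. M $ u $ v) - (\<Sum>u\<in>UNIV. \<Sum>v\<in>UNIV. K u v * M $ u $ v)"
      unfolding sum.cartesian_product[symmetric] by (simp add: left_diff_distrib sum_subtractf)
    also have "\<dots> \<le> (\<Sum>u\<in>UNIV. \<Sum>v\<in>UNIV. M $ u $ v)"
      using pos_kernel_pairing_nonneg[OF pos psd] by simp
    also have "\<dots> = 1 \<bullet> (M *v 1)"
      by (simp add: inner_vec_def matrix_vector_mult_def)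
    finally show ?thesis .
  qed
  \<comment> \<open>The Cauchy--Schwarz inequality, with the weight \<open>1 - K u v \<ge> 1\<close> moved between the factors.\<close>
  have "(\<Sum>(u, v)\<in>R. sqrt (M $ u $ v))\<^sup>2
      = (\<Sum>(u, v)\<in>R. sqrt (1 / (1 - K u v)) * sqrt ((1 - K u v) * M $ u $ v))\<^sup>2"
  proof (intro arg_cong[of _ _ "\<lambda>x. x\<^sup>2"] sum.cong refl, clarify)
    fix u v assume "(u, v) \<in> R"
    then have "1 - K u v > 0" using K_nonpos by force
    then show "sqrt (M $ u $ v) = sqrt (1 / (1 - K u v)) * sqrt ((1 - K u v) * M $ u $ v)"
      by (simp flip: real_sqrt_mult)
  qed
  also have "\<dots> \<le> (\<Sum>(u, v)\<in>R. (sqrt (1 / (1 - K u v)))\<^sup>2) * (\<Sum>(u, v)\<in>R. (sqrt ((1 - K u v) * M $ u $ v))\<^sup>2)"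
    unfolding case_prod_unfold by (rule Cauchy_Schwarz_ineq_sum)
  also have "\<dots> = (\<Sum>(u, v)\<in>R. 1 / (1 - K u v)) * (\<Sum>(u, v)\<in>R. (1 - K u v) * M $ u $ v)"
    using le1 nonneg by simp
  also have "\<dots> \<le> graph_q E * (1 \<bullet> (M *v 1))"
  proof (rule mult_mono[OF q T])
    show "0 \<le> (\<Sum>(u, v)\<in>R. (1 - K u v) * M $ u $ v)"
      using le1 nonneg by (intro sum_nonneg) auto
    have "0 \<le> (\<Sum>(u, v)\<in>R. 1 / (1 - K u v))" using le1 by (intro sum_nonneg) auto
    then show "0 \<le> real_of_int (graph_q E)" using q by linarith
  qed
  finally show ?thesis by (simp add: lhs power_mult_distrib)
qed

end
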